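(* For any integers $k\geq 1$ and $m\geq 2$, the graph $C_{4k}\times P_m$ admits a $(2m-1)$-divisible graceful $\alpha$-labeling.
   Context: $C_n$ ($n\ge 3$) is the cycle on $n$ vertices and $P_m$ ($m\ge 2$) is the path on $m$ vertices. $C_n\times P_m$ denotes their Cartesian product (the grid on a cylinder): its vertices are the pairs $(i,j)$ with $1\le i\le m$, $1\le j\le n$, and its edges are $[(i,j),(i,j+1)]$ (with $j$ taken modulo $n$) for $1\le i\le m$, and $[(i,j),(i+1,j)]$ for $1\le i\le m-1$. The graph $C_{4k}\times P_m$ is bipartite and has $4k(2m-1)$ edges. The size of a graph is its number of edges. Let $\Gamma$ be a graph of size $e=d\cdot q$ with $d,q$ positive integers. A $d$-divisible graceful labeling of $\Gamma$ is an injective function $f:V(\Gamma)\to\{0,1,2,\ldots,d(q+1)-1\}$ such that $$\{|f(x)-f(y)| : [x,y]\in E(\Gamma)\}=\{1,2,3,\ldots,d(q+1)\}\setminus\{q+1,2(q+1),\ldots,d(q+1)\}.$$ If $\Gamma$ is bipartite, a $d$-divisible graceful $\alpha$-labeling of $\Gamma$ is a $d$-divisible graceful labeling $f$ of $\Gamma$ such that the maximum value of $f$ on one of the two bipartite sets is strictly less than its minimum value on the other one. *)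

theory Defs
  imports Main
begin

text \<open>A finite simple graph is given by its vertex set V and its set E of edges, each edge being a
  two-element subset of V; the size of the graph is card E.\<close>

text \<open>The Cartesian product of the cycle on n vertices and the path on m vertices. In a vertex
  (i, j), i is the position in the path and j the position in the cycle; since j ranges over 1, ..., n,
  the cyclic successor of j is j mod n + 1.\<close>

definition cylinder_verts :: "nat \<Rightarrow> nat \<Rightarrow> (nat \<times> nat) set" where
  "cylinder_verts n m = {1..m} \<times> {1..n}"

definition cylinder_edges :: "nat \<Rightarrow> nat \<Rightarrow> (nat \<times> nat) set set" where
  "cylinder_edges n m =
     {{(i, j), (i, j mod n + 1)} | i j. i \<in> {1..m} \<and> j \<in> {1..n}} \<union>
     {{(i, j), (i + 1, j)} | i j. i \<in> {1..m - 1} \<and> j \<in> {1..n}}"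

lemma cylinder_edges_simple:
  assumes "n \<ge> 3" "m \<ge> 2" "e \<in> cylinder_edges n m"
  shows "e \<subseteq> cylinder_verts n m \<and> card e = 2"
proof -
  have "j mod n + 1 \<in> {1..n}" "j \<noteq> j mod n + 1" if "j \<in> {1..n}" for j
    using that assms(1) by (cases "j = n"; auto simp: Suc_le_eq)+
  then show ?thesis
    using assms unfolding cylinder_edges_def cylinder_verts_def
    by (fastforce simp: card_insert_if)
qed

lemma card_cylinder_edges:
  assumes "n \<ge> 3" "m \<ge> 2"
  shows "card (cylinder_edges n m) = n * (2 * m - 1)"
proof -
  define g where "g = (\<lambda>(i::nat, j). {(i, j), (i, j mod n + 1)})"
  define h where "h = (\<lambda>(i::nat, j::nat). {(i, j), (i + 1, j)})"
  let ?A = "{1..m} \<times> {1..n}" and ?B = "{1..m - 1} \<times> {1..n}"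
  have eq: "cylinder_edges n m = g ` ?A \<union> h ` ?B"
    unfolding cylinder_edges_def g_def h_def by fast
  have s: "j mod n + 1 = (if j = n then 1 else j + 1)" if "j \<in> {1..n}" for j
    using that by auto
  have "inj_on g ?A"
  proof (rule inj_onI, clarify)
    fix i j i' j' assume a: "j \<in> {1..n}" "j' \<in> {1..n}" and "g (i, j) = g (i', j')"
    then have "i = i' \<and> (j = j' \<or> j = j' mod n + 1 \<and> j mod n + 1 = j')"
      by (auto simp: g_def doubleton_eq_iff)
    then show "i = i' \<and> j = j'"
      using assms(1) a by (auto simp only: s[OF a(1)] s[OF a(2)] split: if_splits)
  qed
  moreover have "inj_on h ?B"
    by (rule inj_onI) (auto simp: h_def doubleton_eq_iff)
  moreover have "g ` ?A \<inter> h ` ?B = {}"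
    by (auto simp: g_def h_def doubleton_eq_iff)
  ultimately have "card (cylinder_edges n m) = m * n + (m - 1) * n"
    unfolding eq by (subst card_Un_disjoint) (auto simp: card_image)
  also have "\<dots> = n * (2 * m - 1)"
    using assms(2) by (cases m) (auto simp: algebra_simps)
  finally show ?thesis .
qed

definition bipartition :: "'a set \<Rightarrow> 'a set set \<Rightarrow> 'a set \<Rightarrow> 'a set \<Rightarrow> bool" where
  "bipartition V E A B \<longleftrightarrow>
     A \<union> B = V \<and> A \<inter> B = {} \<and> (\<forall>e\<in>E. \<exists>a\<in>A. \<exists>b\<in>B. e = {a, b})"

text \<open>Labels are integers so that subtraction is not truncated. As d and q are positive,
  the condition on card E also forces E to be finite and nonempty.\<close>

definition divisible_graceful_labeling ::
    "nat \<Rightarrow> 'a set \<Rightarrow> 'a set set \<Rightarrow> ('a \<Rightarrow> int) \<Rightarrow> bool" where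
  "divisible_graceful_labeling d V E f \<longleftrightarrow>
     d > 0 \<and>
     (\<exists>q>0. card E = d * q \<and>
        inj_on f V \<and>
        f ` V \<subseteq> {0..int d * (int q + 1) - 1} \<and>
        {\<bar>f x - f y\<bar> | x y. {x, y} \<in> E} =
          {1..int d * (int q + 1)} - {int i * (int q + 1) | i. i \<in> {1..d}})"

text \<open>The two sides of the bipartition are interchangeable, so A can be taken to be the side with
  the smaller labels. Both sides are finite and nonempty, so Max and Min are
  meaningful: V embeds into a finite interval and E is nonempty.\<close>

definition divisible_graceful_alpha_labeling ::
    "nat \<Rightarrow> 'a set \<Rightarrow> 'a set set \<Rightarrow> ('a \<Rightarrow> int) \<Rightarrow> bool" where
  "divisible_graceful_alpha_labeling d V E f \<longleftrightarrow>
     divisible_graceful_labeling d V E f \<and>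
     (\<exists>A B. bipartition V E A B \<and> Max (f ` A) < Min (f ` B))"

end

theory Submission
  imports Defs
begin

text \<open>Start from an \<open>\<alpha>\<close>-labeling \<open>g\<close> of the single cycle on \<open>4k\<close> vertices, whose differences are
  \<open>1, \<dots>, 4k\<close>. The row \<open>i\<close> of the cylinder carries \<open>g\<close> rotated by \<open>i\<close> positions, with \<open>(i - 1)(4k + 1)\<close>
  added to the small labels and \<open>(2m - 1 - i)(4k + 1)\<close> to the large ones. Since consecutive rows differ
  by a rotation by one position, the edges between them join labels of neighbouring
  vertices of the cycle. So each row and each set of edges between consecutive rows realises the
  differences of \<open>g\<close>, translated by its own multiple of \<open>4k + 1\<close>, and the \<open>2m - 1\<close> blocks of length
  \<open>4k\<close> obtained in this way make up the required set.\<close>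

text \<open>The classical zigzag: even positions climb from 0, odd positions descend from
  \<open>4k\<close>. Halfway round the odd labels skip the value \<open>3k\<close>, so the
  differences fall from \<open>4k\<close> to \<open>2k + 1\<close> and then from
  \<open>2k - 1\<close> to 1, and the closing edge supplies \<open>2k\<close>. The position is
  reduced modulo \<open>4k\<close> so that a rotation is a mere shift of the argument.\<close>

definition cycle_label :: "nat \<Rightarrow> nat \<Rightarrow> int" where
  "cycle_label k p = (let r = p mod (4 * k) in
     if even r then int (r div 2)
     else if r < 2 * k then 4 * int k - int (r div 2)
     else 4 * int k - 1 - int (r div 2))"

definition cylinder_label :: "nat \<Rightarrow> nat \<Rightarrow> nat \<times> nat \<Rightarrow> int" where
  "cylinder_label k m = (\<lambda>(i, j). cycle_label k (i + j) +
     (if even (i + j) then int i - 1 else 2 * int m - 1 - int i) * (4 * int k + 1))"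

section \<open>Labels and differences of the single cycle\<close>

lemma even_mod_4k: "even (p mod (4 * k)) \<longleftrightarrow> even (p :: nat)"
  by (simp add: dvd_mod_iff)

lemma cycle_label_cong:
  "p mod (4 * k) = p' mod (4 * k) \<Longrightarrow> cycle_label k p = cycle_label k p'"
  by (simp add: cycle_label_def)

lemma cycle_label_even:
  assumes "k \<ge> 1" "even p"
  shows "0 \<le> cycle_label k p" "cycle_label k p < 2 * int k"
proof -
  define r where "r = p mod (4 * k)"
  have "r < 4 * k" "even r" using assms by (simp_all add: r_def even_mod_4k)
  then show "0 \<le> cycle_label k p" "cycle_label k p < 2 * int k"
    unfolding cycle_label_def Let_def r_def[symmetric] by (auto elim!: evenE)
qed

lemma cycle_label_odd:
  assumes "k \<ge> 1" "odd p"
  shows "2 * int k \<le> cycle_label k p" "cycle_label k p \<le> 4 * int k"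
proof -
  define r where "r = p mod (4 * k)"
  have "r < 4 * k" "odd r" using assms by (simp_all add: r_def even_mod_4k)
  then show "2 * int k \<le> cycle_label k p" "cycle_label k p \<le> 4 * int k"
    unfolding cycle_label_def Let_def r_def[symmetric] by (auto elim!: oddE)
qed

text \<open>On each parity class the label is strictly monotone in the residue: increasing on even
  residues, decreasing on odd ones, also across the skipped value.\<close>

lemma cycle_label_inj:
  assumes "k \<ge> 1" "even p = even p'" "cycle_label k p = cycle_label k p'"
  shows "p mod (4 * k) = p' mod (4 * k)"
proof -
  have "even (p mod (4 * k)) = even (p' mod (4 * k))"
    using assms(2) by (simp add: even_mod_4k)
  moreover have "p mod (4 * k) < 4 * k" "p' mod (4 * k) < 4 * k"
    using assms(1) by auto
  ultimately show ?thesis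
    using assms(3) unfolding cycle_label_def Let_def
    by (auto split: if_splits elim!: evenE oddE)
qed

text \<open>Consecutive positions have opposite parity, so one label lies in \<open>[0, 2k)\<close>
  and the other in \<open>[2k, 4k]\<close>.\<close>

lemma cycle_label_diff_le:
  assumes "k \<ge> 1"
  shows "\<bar>cycle_label k p - cycle_label k (Suc p)\<bar> \<in> {1..4 * int k}"
  using cycle_label_even[OF assms, of p] cycle_label_odd[OF assms, of p]
    cycle_label_even[OF assms, of "Suc p"] cycle_label_odd[OF assms, of "Suc p"]
  by (cases "even p") auto

lemma cycle_label_simps:
  "a < 2 * k \<Longrightarrow> cycle_label k (2 * a) = int a"
  "a < k \<Longrightarrow> cycle_label k (Suc (2 * a)) = 4 * int k - int a"
  "k \<le> a \<Longrightarrow> a < 2 * k \<Longrightarrow> cycle_label k (Suc (2 * a)) = 4 * int k - 1 - int a"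
  by (simp_all add: cycle_label_def Let_def)

text \<open>The witnesses invert the zigzag. The edge leaving position \<open>2a\<close> has
  difference \<open>4k - 2a\<close> if \<open>a < k\<close> and \<open>4k - 1 - 2a\<close>
  otherwise; the edge leaving \<open>2a + 1\<close> has one less, except for the closing
  edge.\<close>

lemma cycle_label_diff_surj:
  assumes "k \<ge> 1" "r \<in> {1..4 * int k}"
  shows "\<exists>p. \<bar>cycle_label k p - cycle_label k (Suc p)\<bar> = r"
proof -
  define b where "b = nat r div 2"
  consider "r = 2 * int b" "b < k" "b > 0" | "b = k" "r = 2 * int b"
    | "r = 2 * int b" "b > k" "b \<le> 2 * k"
    | "r = 2 * int b + 1" "b < k" | "r = 2 * int b + 1" "k \<le> b" "b < 2 * k"
  proof -
    have "r = 2 * int b \<or> r = 2 * int b + 1" "1 \<le> r" "r \<le> 4 * int k"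
      using assms by (auto simp: b_def zdiv_int)
    then show thesis using that by (cases b k rule: linorder_cases) linarith+
  qed
  then show ?thesis
  proof cases
    case 1
    have "Suc (Suc (2 * (2 * k - 1 - b))) = 2 * (2 * k - b)" using 1 by auto
    then show ?thesis using 1
      by (intro exI[of _ "Suc (2 * (2 * k - 1 - b))"]) (simp add: cycle_label_simps)
  next
    case 2
    \<comment> \<open>The closing edge joins position \<open>4k - 1\<close>, labelled
      \<open>2k\<close>, to position \<open>4k\<close>, which is position 0 again.\<close>
    have "cycle_label k (Suc (2 * (2 * k - 1))) = 2 * int k"
      using assms(1) by (simp add: cycle_label_simps)
    moreover have "Suc (Suc (2 * (2 * k - 1))) = 4 * k" using assms(1) by simp
    then have "cycle_label k (Suc (Suc (2 * (2 * k - 1)))) = 0"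
      by (simp add: cycle_label_def)
    ultimately show ?thesis using 2
      by (intro exI[of _ "Suc (2 * (2 * k - 1))"]) simp
  next
    case 3
    then show ?thesis
      by (intro exI[of _ "2 * (2 * k - b)"]) (simp add: cycle_label_simps)
  next
    case 4
    then show ?thesis
      by (intro exI[of _ "2 * (2 * k - 1 - b)"]) (simp add: cycle_label_simps)
  next
    case 5
    have "Suc (Suc (2 * (2 * k - 1 - b))) = 2 * (2 * k - b)" using 5 by auto
    then show ?thesis using 5 assms(1)
      by (intro exI[of _ "Suc (2 * (2 * k - 1 - b))"]) (simp add: cycle_label_simps)
  qed
qed

section \<open>Edge differences on the cylinder\<close>

lemma ex_shift_mod:
  fixes n i p :: nat
  assumes "n \<ge> 1"
  shows "\<exists>j\<in>{1..n}. (i + j) mod n = p mod n"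
proof -
  \<comment> \<open>Modulo \<open>n\<close>, \<open>i * (n - 1)\<close> is \<open>-i\<close>; this
    form avoids truncated subtraction. Residue 0 is later represented by \<open>n\<close>, as
    positions start at 1.\<close>
  define x where "x = (p + i * (n - 1)) mod n"
  have "(i + x) mod n = (i + (p + i * (n - 1))) mod n"
    by (simp add: x_def mod_add_right_eq)
  also have "i + (p + i * (n - 1)) = p + i * n"
    using assms by (cases n) auto
  finally have x: "(i + x) mod n = p mod n" by simp
  show ?thesis
  proof (cases "x = 0")
    case True
    then show ?thesis using x assms by (intro bexI[of _ n]) auto
  next
    case False
    moreover have "x < n" using assms by (simp add: x_def)
    ultimately show ?thesis using x by (intro bexI[of _ x]) auto
  qed
qed

text \<open>Wrapping from \<open>4k\<close> to 1 changes the position by a multiple of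
  \<open>4k\<close>, which is even, so the parity still flips as at any other step.\<close>

lemma row_successor:
  "(i + (j mod (4 * k) + 1)) mod (4 * k) = Suc (i + j) mod (4 * k)"
  "even (i + (j mod (4 * k) + 1)) \<longleftrightarrow> odd (i + j)"
  by (metis Suc_eq_plus1 add.assoc add.commute mod_add_right_eq) (simp add: even_mod_4k)

lemma cylinder_label_row_diff:
  assumes "k \<ge> 1" "i \<le> m"
  shows "\<bar>cylinder_label k m (i, j) - cylinder_label k m (i, j mod (4 * k) + 1)\<bar> =
    (2 * int m - 2 * int i) * (4 * int k + 1) +
    \<bar>cycle_label k (i + j) - cycle_label k (Suc (i + j))\<bar>"
proof -
  define N where "N = 4 * int k + 1"
  \<comment> \<open>The large offset exceeds the small one by \<open>2 * P\<close>. As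
    \<open>P\<close> is nonnegative and large cycle labels exceed small ones, the two differences
    add up inside the absolute value.\<close>
  define P where "P = (int m - int i) * N"
  have P: "P \<ge> 0" using assms by (simp add: P_def N_def)
  have eqs: "(2 * int m - 1 - int i) * N = (int i - 1) * N + 2 * P"
    "(2 * int m - 2 * int i) * N = 2 * P"
    by (simp_all add: P_def algebra_simps)
  show ?thesis
    using P eqs cycle_label_cong[OF row_successor(1)[of i j k]] row_successor(2)[of i j k]
      cycle_label_even[OF assms(1), of "i + j"] cycle_label_odd[OF assms(1), of "i + j"]
      cycle_label_even[OF assms(1), of "Suc (i + j)"] cycle_label_odd[OF assms(1), of "Suc (i + j)"]
    unfolding cylinder_label_def prod.case N_def[symmetric]
    by (cases "even (i + j)") auto
qed

text \<open>Going down one row raises the small offset and lowers the large one, each by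
  \<open>4k + 1\<close>. So the gap between the offsets is the same whichever end carries the small
  label.\<close>

lemma cylinder_label_column_diff:
  assumes "k \<ge> 1" "i < m"
  shows "\<bar>cylinder_label k m (i, j) - cylinder_label k m (i + 1, j)\<bar> =
    (2 * int m - 1 - 2 * int i) * (4 * int k + 1) +
    \<bar>cycle_label k (i + j) - cycle_label k (Suc (i + j))\<bar>"
proof -
  define N where "N = 4 * int k + 1"
  define P where "P = (int m - 1 - int i) * N"
  have P: "P \<ge> 0" "N \<ge> 0" using assms by (simp_all add: P_def N_def)
  define Q where "Q = (int i - 1) * N"
  have "cylinder_label k m (i, j) = cycle_label k (i + j) +
      (if even (i + j) then Q else Q + 2 * P + 2 * N)"
    by (simp add: cylinder_label_def N_def P_def Q_def algebra_simps)
  moreover have "cylinder_label k m (i + 1, j) = cycle_label k (Suc (i + j)) +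
      (if even (i + j) then Q + 2 * P + N else Q + N)"
    by (simp add: cylinder_label_def N_def P_def Q_def algebra_simps)
  moreover have "(2 * int m - 1 - 2 * int i) * (4 * int k + 1) = 2 * P + N"
    by (simp add: P_def N_def algebra_simps)
  ultimately show ?thesis
    using P cycle_label_even[OF assms(1), of "i + j"] cycle_label_odd[OF assms(1), of "i + j"]
      cycle_label_even[OF assms(1), of "Suc (i + j)"] cycle_label_odd[OF assms(1), of "Suc (i + j)"]
    by (cases "even (i + j)") auto
qed

text \<open>Division by \<open>n + 1\<close>: the removed numbers are those with remainder 0, and
  the quotient of any other number names its block.\<close>

lemma Un_blocks_eq:
  fixes n :: int
  assumes "n \<ge> 0"
  shows "{1..int d * (n + 1)} - {int i * (n + 1) | i. i \<in> {1..d}} =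
    {int t * (n + 1) + r | t r. t < d \<and> r \<in> {1..n}}" (is "?L = ?R")
proof (intro equalityI subsetI)
  fix x assume x: "x \<in> ?L"
  define t where "t = x div (n + 1)"
  define r where "r = x mod (n + 1)"
  have xtr: "x = t * (n + 1) + r" by (simp only: t_def r_def div_mult_mod_eq)
  have r: "0 \<le> r" "r \<le> n"
    using assms pos_mod_bound[of "n + 1" x] by (simp_all add: r_def)
  have t0: "0 \<le> t" using x assms by (simp add: t_def pos_imp_zdiv_nonneg_iff)
  have r0: "r \<noteq> 0"
  proof
    assume "r = 0"
    then have e: "x = int (nat t) * (n + 1)" using xtr t0 by simp
    have "nat t \<in> {1..d}"
    proof -
      have "t \<noteq> 0" using x e by auto
      moreover have "t \<le> int d"
        using x e t0 assms by (simp add: mult_le_cancel_right)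
      ultimately show ?thesis using t0 by auto
    qed
    then show False using x e by blast
  qed
  have "x \<le> int d * (n + 1)" using x by auto
  then have "t * (n + 1) < int d * (n + 1)" using xtr r r0 by linarith
  then have "t < int d" using assms by (simp add: mult_less_cancel_right)
  then have "nat t < d" "x = int (nat t) * (n + 1) + r" "r \<in> {1..n}"
    using t0 r r0 xtr by auto
  then show "x \<in> ?R" by blast
next
  fix x assume "x \<in> ?R"
  then obtain t r where x: "x = int t * (n + 1) + r" "t < d" "1 \<le> r" "r \<le> n" by auto
  have "int t + 1 \<le> int d" using x by simp
  then have "(int t + 1) * (n + 1) \<le> int d * (n + 1)"
    using assms by (intro mult_right_mono) auto
  moreover have "(int t + 1) * (n + 1) = int t * (n + 1) + n + 1" by (simp add: algebra_simps)
  moreover have "int t * (n + 1) \<ge> 0" using assms by simp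
  ultimately have "1 \<le> x" "x \<le> int d * (n + 1)" using x by linarith+
  then have "x \<in> {1..int d * (n + 1)}" by simp
  moreover have "x \<noteq> int i * (n + 1)" for i
  proof
    assume "x = int i * (n + 1)"
    then have "x mod (n + 1) = 0" by simp
    moreover have "x mod (n + 1) = r" using x by simp
    ultimately show False using x by simp
  qed
  ultimately show "x \<in> ?L" by blast
qed

text \<open>Row \<open>i\<close> fills block \<open>2m - 2i\<close>, and the edges from row
  \<open>i\<close> to row \<open>i + 1\<close> fill block \<open>2m - 1 - 2i\<close>. The even and
  odd block indices below \<open>2m - 1\<close> are thus each met exactly once.\<close>

lemma cylinder_label_edge_labels:
  assumes "k \<ge> 1" "m \<ge> 2"
  shows "{\<bar>cylinder_label k m x - cylinder_label k m y\<bar> | x y. {x, y} \<in> cylinder_edges (4 * k) m} =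
    {int t * (4 * int k + 1) + r | t r. t < 2 * m - 1 \<and> r \<in> {1..4 * int k}}" (is "?L = ?R")
proof (intro equalityI subsetI)
  let ?f = "cylinder_label k m"
  fix z assume "z \<in> ?L"
  then obtain x y where e: "{x, y} \<in> cylinder_edges (4 * k) m" and z: "z = \<bar>?f x - ?f y\<bar>"
    by blast
  from e consider
      i j where "{x, y} = {(i, j), (i, j mod (4 * k) + 1)}" "i \<in> {1..m}"
    | i j where "{x, y} = {(i, j), (i + 1, j)}" "i \<in> {1..m - 1}"
    unfolding cylinder_edges_def by blast
  then show "z \<in> ?R"
  proof cases
    case 1
    have "z = \<bar>?f (i, j) - ?f (i, j mod (4 * k) + 1)\<bar>"
      using 1(1) z by (auto simp: doubleton_eq_iff abs_minus_commute)
    then have "z = int (2 * m - 2 * i) * (4 * int k + 1) +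
        \<bar>cycle_label k (i + j) - cycle_label k (Suc (i + j))\<bar>"
      using cylinder_label_row_diff[OF assms(1), of i m j] 1(2) by (simp add: of_nat_diff)
    moreover have "2 * m - 2 * i < 2 * m - 1" using 1(2) assms(2) by auto
    ultimately show ?thesis using cycle_label_diff_le[OF assms(1), of "i + j"] by blast
  next
    case 2
    have "z = \<bar>?f (i, j) - ?f (i + 1, j)\<bar>"
      using 2(1) z by (auto simp: doubleton_eq_iff abs_minus_commute)
    moreover have "int (2 * m - 1 - 2 * i) = 2 * int m - 1 - 2 * int i" "i < m"
      using 2(2) by auto
    ultimately have "z = int (2 * m - 1 - 2 * i) * (4 * int k + 1) +
        \<bar>cycle_label k (i + j) - cycle_label k (Suc (i + j))\<bar>"
      using cylinder_label_column_diff[OF assms(1), of i m j] by simp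
    moreover have "2 * m - 1 - 2 * i < 2 * m - 1" using 2(2) by auto
    ultimately show ?thesis using cycle_label_diff_le[OF assms(1), of "i + j"] by blast
  qed
next
  let ?f = "cylinder_label k m"
  fix z assume "z \<in> ?R"
  then obtain t r where z: "z = int t * (4 * int k + 1) + r" and t: "t < 2 * m - 1"
    and r: "r \<in> {1..4 * int k}" by blast
  obtain p where p: "\<bar>cycle_label k p - cycle_label k (Suc p)\<bar> = r"
    using cycle_label_diff_surj[OF assms(1) r] by blast
  \<comment> \<open>Solves \<open>t = 2m - 2i\<close> for even \<open>t\<close> and
    \<open>t = 2m - 1 - 2i\<close> for odd \<open>t\<close> at once.\<close>
  define i where "i = m - (t + 1) div 2"
  obtain j where j: "j \<in> {1..4 * k}" "(i + j) mod (4 * k) = p mod (4 * k)"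
    using ex_shift_mod[of "4 * k" i p] assms(1) by auto
  have "Suc (i + j) mod (4 * k) = Suc p mod (4 * k)"
    using j(2) by (metis mod_Suc_eq)
  then have d: "\<bar>cycle_label k (i + j) - cycle_label k (Suc (i + j))\<bar> = r"
    using p cycle_label_cong j(2) by metis
  show "z \<in> ?L"
  proof (cases "even t")
    case True
    then have i: "i \<in> {1..m}" "int t = 2 * int m - 2 * int i"
      using t by (auto simp: i_def elim!: evenE)
    then have "z = \<bar>?f (i, j) - ?f (i, j mod (4 * k) + 1)\<bar>"
      using cylinder_label_row_diff[OF assms(1), of i m j] d z by simp
    moreover have "{(i, j), (i, j mod (4 * k) + 1)} \<in> cylinder_edges (4 * k) m"
      using i j unfolding cylinder_edges_def by blast
    ultimately show ?thesis by blast
  next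
    case False
    then have i: "i \<in> {1..m - 1}" "i < m" "int t = 2 * int m - 1 - 2 * int i"
      using t by (auto simp: i_def elim!: oddE)
    then have "z = \<bar>?f (i, j) - ?f (i + 1, j)\<bar>"
      using cylinder_label_column_diff[OF assms(1), of i m j] d z by simp
    moreover have "{(i, j), (i + 1, j)} \<in> cylinder_edges (4 * k) m"
      using i j unfolding cylinder_edges_def by blast
    ultimately show ?thesis by blast
  qed
qed

section \<open>Separation and injectivity of the cylinder labels\<close>

text \<open>The largest offset of a small label and the smallest offset of a large one coincide:
  both are \<open>(m - 1)(4k + 1)\<close>, in row \<open>m\<close>. There the threshold
  \<open>2k\<close> of the cycle labels does the separating.\<close>

lemma cylinder_label_even:
  assumes "k \<ge> 1" "i \<in> {1..m}" "even (i + j)"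
  shows "0 \<le> cylinder_label k m (i, j)"
    "cylinder_label k m (i, j) < (int m - 1) * (4 * int k + 1) + 2 * int k"
proof -
  have "(int i - 1) * (4 * int k + 1) \<le> (int m - 1) * (4 * int k + 1)"
    "0 \<le> (int i - 1) * (4 * int k + 1)"
    using assms(2) by (auto intro!: mult_right_mono)
  moreover have "cylinder_label k m (i, j) = cycle_label k (i + j) + (int i - 1) * (4 * int k + 1)"
    using assms(3) by (simp add: cylinder_label_def)
  ultimately show "0 \<le> cylinder_label k m (i, j)"
    "cylinder_label k m (i, j) < (int m - 1) * (4 * int k + 1) + 2 * int k"
    using cycle_label_even[OF assms(1,3)] by linarith+
qed

lemma cylinder_label_odd:
  assumes "k \<ge> 1" "i \<in> {1..m}" "odd (i + j)"
  shows "(int m - 1) * (4 * int k + 1) + 2 * int k \<le> cylinder_label k m (i, j)"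
    "cylinder_label k m (i, j) \<le> (2 * int m - 2) * (4 * int k + 1) + 4 * int k"
proof -
  have "(int m - 1) * (4 * int k + 1) \<le> (2 * int m - 1 - int i) * (4 * int k + 1)"
    "(2 * int m - 1 - int i) * (4 * int k + 1) \<le> (2 * int m - 2) * (4 * int k + 1)"
    using assms(2) by (auto intro!: mult_right_mono)
  moreover have "cylinder_label k m (i, j) =
      cycle_label k (i + j) + (2 * int m - 1 - int i) * (4 * int k + 1)"
    using assms(3) by (simp add: cylinder_label_def)
  ultimately show "(int m - 1) * (4 * int k + 1) + 2 * int k \<le> cylinder_label k m (i, j)"
    "cylinder_label k m (i, j) \<le> (2 * int m - 2) * (4 * int k + 1) + 4 * int k"
    using cycle_label_odd[OF assms(1,3)] by linarith+
qed

text \<open>Uniqueness of quotient and remainder; it lets a cylinder label be decoded into its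
  offset and its cycle label.\<close>

lemma mult_add_eq_iff:
  fixes n :: int
  assumes "0 \<le> r" "r \<le> n" "0 \<le> s" "s \<le> n"
  shows "r + a * (n + 1) = s + b * (n + 1) \<longleftrightarrow> a = b \<and> r = s"
proof
  assume eq: "r + a * (n + 1) = s + b * (n + 1)"
  then have "(r + a * (n + 1)) mod (n + 1) = (s + b * (n + 1)) mod (n + 1)" by simp
  then have "r = s" using assms by simp
  then show "a = b \<and> r = s" using eq assms by simp
qed simp

lemma mod_shift_inj:
  fixes n i j j' :: nat
  assumes "j \<in> {1..n}" "j' \<in> {1..n}" "(i + j) mod n = (i + j') mod n"
  shows "j = j'"
proof -
  have "int n dvd int (i + j) - int (i + j')"
    using assms(3) by (metis mod_eq_dvd_iff of_nat_mod)
  then have "int n dvd int j - int j'" by simp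
  moreover have "\<bar>int j - int j'\<bar> < int n" using assms by auto
  ultimately show ?thesis using dvd_imp_le_int[of "int j - int j'" "int n"] by auto
qed

lemma inj_on_cylinder_label:
  assumes "k \<ge> 1"
  shows "inj_on (cylinder_label k m) (cylinder_verts (4 * k) m)"
proof (rule inj_onI, clarify)
  fix i j i' j'
  assume v: "(i, j) \<in> cylinder_verts (4 * k) m" "(i', j') \<in> cylinder_verts (4 * k) m"
    and eq: "cylinder_label k m (i, j) = cylinder_label k m (i', j')"
  have i: "i \<in> {1..m}" "i' \<in> {1..m}" and j: "j \<in> {1..4 * k}" "j' \<in> {1..4 * k}"
    using v by (auto simp: cylinder_verts_def)
  \<comment> \<open>Equal labels lie on the same side of the separating value, which fixes the
    parity.\<close>
  have par: "even (i + j) = even (i' + j')"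
    using cylinder_label_even[OF assms i(1), of j] cylinder_label_odd[OF assms i(1), of j]
      cylinder_label_even[OF assms i(2), of j'] cylinder_label_odd[OF assms i(2), of j'] eq
    by (cases "even (i + j)"; cases "even (i' + j')") auto
  have rng: "0 \<le> cycle_label k p" "cycle_label k p \<le> 4 * int k" for p
    using cycle_label_even[OF assms, of p] cycle_label_odd[OF assms, of p]
    by (cases "even p"; simp)+
  \<comment> \<open>With the parity known, the offset determines the row.\<close>
  have "i = i' \<and> cycle_label k (i + j) = cycle_label k (i' + j')"
    using eq par mult_add_eq_iff[OF rng[of "i + j"] rng[of "i' + j'"]]
    by (auto simp: cylinder_label_def split: if_splits)
  then show "i = i' \<and> j = j'"
    using cycle_label_inj[OF assms par] mod_shift_inj[OF j] by auto
qed

theorem theorem3p1: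
  fixes k m :: nat
  assumes "k \<ge> 1" and "m \<ge> 2"
  shows "\<exists>f. divisible_graceful_alpha_labeling (2 * m - 1)
           (cylinder_verts (4 * k) m) (cylinder_edges (4 * k) m) f"
proof -
  let ?V = "cylinder_verts (4 * k) m" and ?E = "cylinder_edges (4 * k) m"
  let ?f = "cylinder_label k m"
  define A where "A = {(i, j) \<in> ?V. even (i + j)}"
  define B where "B = {(i, j) \<in> ?V. odd (i + j)}"
  have d: "int (2 * m - 1) = 2 * int m - 1" using assms by auto
  have range: "?f ` ?V \<subseteq> {0..int (2 * m - 1) * (int (4 * k) + 1) - 1}"
  proof clarify
    fix i j assume "(i, j) \<in> ?V"
    then have i: "i \<in> {1..m}" by (simp add: cylinder_verts_def)
    have "0 \<le> (int m - 1) * (4 * int k + 1)" using assms by simp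
    moreover have two: "(2 * int m - 2) * (4 * int k + 1) = 2 * ((int m - 1) * (4 * int k + 1))"
      by (simp add: algebra_simps)
    ultimately have "0 \<le> ?f (i, j) \<and> ?f (i, j) \<le> (2 * int m - 2) * (4 * int k + 1) + 4 * int k"
      using cylinder_label_even[OF assms(1) i, of j] cylinder_label_odd[OF assms(1) i, of j]
      by (cases "even (i + j)") linarith+
    moreover have "int (2 * m - 1) * (int (4 * k) + 1) - 1 =
        (2 * int m - 2) * (4 * int k + 1) + 4 * int k"
      unfolding d by (simp add: algebra_simps)
    ultimately show "?f (i, j) \<in> {0..int (2 * m - 1) * (int (4 * k) + 1) - 1}"
      by (simp only: atLeastAtMost_iff)
  qed
  have "divisible_graceful_labeling (2 * m - 1) ?V ?E ?f"
    unfolding divisible_graceful_labeling_def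
  \<comment> \<open>Here \<open>q\<close> is the block length \<open>4k\<close>, so
    \<open>q + 1\<close> is the unit by which the blocks are translated.\<close>
  proof (intro conjI exI[of _ "4 * k"])
    show "card ?E = (2 * m - 1) * (4 * k)"
      using card_cylinder_edges[of "4 * k" m] assms by simp
    show "{\<bar>?f x - ?f y\<bar> | x y. {x, y} \<in> ?E} = {1..int (2 * m - 1) * (int (4 * k) + 1)} -
        {int i * (int (4 * k) + 1) | i. i \<in> {1..2 * m - 1}}"
      unfolding cylinder_label_edge_labels[OF assms]
      by (subst Un_blocks_eq) simp_all
    show "inj_on ?f ?V" by (rule inj_on_cylinder_label[OF assms(1)])
    show "?f ` ?V \<subseteq> {0..int (2 * m - 1) * (int (4 * k) + 1) - 1}" by (rule range)
  qed (use assms in simp_all)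
  moreover have "bipartition ?V ?E A B"
    unfolding bipartition_def
  proof (intro conjI ballI)
    show "A \<union> B = ?V" "A \<inter> B = {}" by (auto simp: A_def B_def)
    fix e assume e: "e \<in> ?E"
    then have sub: "e \<subseteq> ?V" using cylinder_edges_simple[of "4 * k" m e] assms by auto
    \<comment> \<open>Both kinds of edge flip the parity of the coordinate sum, so the checkerboard
      colouring is a bipartition.\<close>
    from e consider i j where "e = {(i, j), (i, j mod (4 * k) + 1)}" | i j where "e = {(i, j), (i + 1, j)}"
      unfolding cylinder_edges_def by blast
    then obtain i j i' j' where ij: "e = {(i, j), (i', j')}" "even (i' + j') \<longleftrightarrow> odd (i + j)"
    proof cases
      case (1 i j)
      then show ?thesis using that row_successor(2) by blast
    next
      case (2 i j)
      moreover have "even (i + 1 + j) \<longleftrightarrow> odd (i + j)" by simp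
      ultimately show ?thesis using that by blast
    qed
    show "\<exists>a\<in>A. \<exists>b\<in>B. e = {a, b}"
    proof (cases "even (i + j)")
      case True
      then have "(i, j) \<in> A" "(i', j') \<in> B" using ij sub by (simp_all add: A_def B_def)
      then show ?thesis using ij(1) by blast
    next
      case False
      then have "(i', j') \<in> A" "(i, j) \<in> B" using ij sub by (simp_all add: A_def B_def)
      then show ?thesis using ij(1) by (metis insert_commute)
    qed
  qed
  moreover have "Max (?f ` A) < Min (?f ` B)"
  proof -
    have "A \<subseteq> ?V" "B \<subseteq> ?V" "finite ?V" by (auto simp: A_def B_def cylinder_verts_def)
    then have fin: "finite A" "finite B" by (blast intro: finite_subset)+
    \<comment> \<open>Nonempty sides are required for \<open>Max\<close> and \<open>Min\<close> to
      be meaningful.\<close>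
    have "(1, 1) \<in> A" "(1, 2) \<in> B" using assms by (auto simp: A_def B_def cylinder_verts_def)
    then have ne: "A \<noteq> {}" "B \<noteq> {}" by auto
    define c where "c = (int m - 1) * (4 * int k + 1) + 2 * int k"
    have "\<forall>a\<in>A. ?f a < c" "\<forall>b\<in>B. c \<le> ?f b"
      using cylinder_label_even(2)[OF assms(1)] cylinder_label_odd(1)[OF assms(1)]
      by (auto simp: A_def B_def cylinder_verts_def c_def)
    then have "?f a < ?f b" if "a \<in> A" "b \<in> B" for a b
      using that by force
    then show ?thesis using fin ne by simp
  qed
  ultimately show ?thesis unfolding divisible_graceful_alpha_labeling_def by blast
qed

end
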